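(* Let $\mathcal{A}$ be a unit associative algebra over $\mathbb{K}\in\{\mathbb{R},\mathbb{C}\}$. An edge based map $p=(p^1,\dots,p^n):\vec{\mathcal{E}}(\mathbb{Z}^n)\to\mathcal{A}$ is a parallelogram net if and only if its Lax representation $$P^i(\lambda,\mu)=\lambda+\mu p^i,\qquad\lambda,\mu\in\mathbb{K},$$ fulfills the compatibility condition $P^j_iP^i=P^i_jP^j$ on every quad (for all $\lambda,\mu\in\mathbb{K}$).
   Context: $\vec{\mathcal{E}}(\mathbb{Z}^n)$ is the set of directed edges $(x,x+e_i)$ of $\mathbb{Z}^n$. An edge based map $p=(p^1,\dots,p^n)$ assigns $p^i(x)$ to the edge $(x,x+e_i)$; write $p^i=p^i(x)$ and $p^i_j=p^i(x+e_j)$, and similarly for $P$. A scalar $\lambda$ stands for $\lambda\cdot1\in\mathcal{A}$. A parallelogram net is an edge based map such that on every quad $p^i+p^j_i=p^j+p^i_j$ and $p^j_ip^i=p^i_jp^j$. *)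

theory Defs
  imports "HOL-Analysis.Finite_Cartesian_Product"
begin

text \<open>Associative algebras with unit over a field. The sort \<open>{ring, monoid_mult}\<close> is used instead
  of \<open>ring_1\<close> because the latter also demands \<open>0 \<noteq> 1\<close>.\<close>

locale unital_algebra = vector_space scale
  for scale :: "'k::field \<Rightarrow> 'a::{ring, monoid_mult} \<Rightarrow> 'a" +
  assumes scale_mult_left: "scale c x * y = scale c (x * y)"
    and scale_mult_right: "x * scale c y = scale c (x * y)"

lemma unital_algebra_scaleR:
  "unital_algebra (scaleR :: real \<Rightarrow> 'a::real_algebra_1 \<Rightarrow> 'a)"
  by unfold_locales (simp_all add: algebra_simps)

text \<open>The lattice \<open>\<int>\<^sup>n\<close> is \<open>int ^ 'n\<close> with \<open>n = CARD('n)\<close>, and \<open>e\<^sub>i = axis i 1\<close>. The directed edge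
  \<open>(x, x + e\<^sub>i)\<close> is determined by its direction \<open>i\<close> and its initial point \<open>x\<close>; the value
  \<open>p\<^sup>i(x)\<close> of an edge based map is \<open>p i x\<close>, and the shifted value \<open>p\<^sup>i\<^sub>j\<close> is
  \<open>p i (x + axis j 1)\<close>.\<close>

type_synonym ('n, 'a) edge_map = "'n \<Rightarrow> int ^ 'n \<Rightarrow> 'a"

text \<open>The quads are spanned at \<open>x\<close> by two different directions \<open>i\<close> and \<open>j\<close>.\<close>

definition additive_closing :: "('n::finite, 'a::{ring, monoid_mult}) edge_map \<Rightarrow> bool" where
  "additive_closing p \<longleftrightarrow>
     (\<forall>x i j. i \<noteq> j \<longrightarrow> p i x + p j (x + axis i 1) = p j x + p i (x + axis j 1))"

definition multiplicative_compat :: "('n::finite, 'a::{ring, monoid_mult}) edge_map \<Rightarrow> bool" where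
  "multiplicative_compat p \<longleftrightarrow>
     (\<forall>x i j. i \<noteq> j \<longrightarrow> p j (x + axis i 1) * p i x = p i (x + axis j 1) * p j x)"

definition parallelogram_net :: "('n::finite, 'a::{ring, monoid_mult}) edge_map \<Rightarrow> bool" where
  "parallelogram_net p \<longleftrightarrow> additive_closing p \<and> multiplicative_compat p"

definition lax_rep ::
  "('k \<Rightarrow> 'a \<Rightarrow> 'a) \<Rightarrow> ('n::finite, 'a::{ring, monoid_mult}) edge_map \<Rightarrow> 'k \<Rightarrow> 'k \<Rightarrow> ('n, 'a) edge_map" where
  "lax_rep smul p l m = (\<lambda>i x. smul l 1 + smul m (p i x))"

end

theory Submission
  imports Defs
begin

text \<open>The product \<open>(\<lambda> + \<mu> b) (\<lambda> + \<mu> a)\<close> is a polynomial in \<open>\<lambda>\<close> and \<open>\<mu>\<close> with coefficients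
  \<open>1\<close>, \<open>a + b\<close> and \<open>b a\<close>, the two sides of the conditions defining a parallelogram net. Evaluation
  at \<open>(0, 1)\<close> and \<open>(1, 1)\<close> already separates the last two, so no assumption on the field is needed.\<close>

context unital_algebra
begin

lemma lax_factor_mult:
  "(scale l 1 + scale m b) * (scale l 1 + scale m a) =
     scale (l * l) 1 + scale (l * m) (a + b) + scale (m * m) (b * a)"
  by (simp add: distrib_left distrib_right scale_mult_left scale_mult_right
      scale_right_distrib mult.commute add_ac)

lemma lax_compat_iff:
  "(\<forall>l m. (scale l 1 + scale m b) * (scale l 1 + scale m a) =
          (scale l 1 + scale m d) * (scale l 1 + scale m c)) \<longleftrightarrow>
     a + b = c + d \<and> b * a = d * c"
  (is "(\<forall>l m. ?compat l m) \<longleftrightarrow> _")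
proof
  assume compat: "\<forall>l m. ?compat l m"
  have "b * a = d * c"
    using compat[rule_format, of 0 1] by simp
  \<comment> \<open>At (1, 1) both expansions have the summand \<open>1\<close>, and the products
    agree by the evaluation at (0, 1), so cancellation leaves the sums.\<close>
  moreover have "a + b = c + d"
    using compat[rule_format, of 1 1] \<open>b * a = d * c\<close> unfolding lax_factor_mult by simp
  ultimately show "a + b = c + d \<and> b * a = d * c" by simp
next
  assume "a + b = c + d \<and> b * a = d * c"
  then show "\<forall>l m. ?compat l m" unfolding lax_factor_mult by simp
qed

lemma parallelogram_net_iff_lax_compat:
  fixes p :: "('n::finite, 'a) edge_map"
  shows "parallelogram_net p \<longleftrightarrow> (\<forall>l m. multiplicative_compat (lax_rep scale p l m))"
proof -
  have "(\<forall>l m. multiplicative_compat (lax_rep scale p l m)) \<longleftrightarrow>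
      (\<forall>x i j. i \<noteq> j \<longrightarrow>
        p i x + p j (x + axis i 1) = p j x + p i (x + axis j 1) \<and>
        p j (x + axis i 1) * p i x = p i (x + axis j 1) * p j x)"
    \<comment> \<open>Used from right to left, the equivalence acts on each quad separately; the two
      sides then differ only in the order of quantifiers.\<close>
    unfolding multiplicative_compat_def lax_rep_def lax_compat_iff[symmetric] by blast
  then show ?thesis
    unfolding parallelogram_net_def additive_closing_def multiplicative_compat_def by blast
qed

end

text \<open>The conjuncts are the real and the complex case, both instances of the equivalence over
  an arbitrary field.\<close>

theorem proposition2p8:
  fixes p :: "('n::finite, 'a::{ring, monoid_mult}) edge_map"
    and scale_real :: "real \<Rightarrow> 'a \<Rightarrow> 'a"
    and scale_complex :: "complex \<Rightarrow> 'a \<Rightarrow> 'a"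
  shows
    "(unital_algebra scale_real \<longrightarrow>
        (parallelogram_net p \<longleftrightarrow>
          (\<forall>l m. multiplicative_compat (lax_rep scale_real p l m)))) \<and>
     (unital_algebra scale_complex \<longrightarrow>
        (parallelogram_net p \<longleftrightarrow>
          (\<forall>l m. multiplicative_compat (lax_rep scale_complex p l m))))"
  by (intro conjI impI unital_algebra.parallelogram_net_iff_lax_compat)

end
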